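(* Let $F,G\subset[0,1]$ be the Cantor-like sets constructed in the context. Then $\dim_{B}(F\times G)<\dim_{B}(F)+\dim_{B}(G)$.
   Context: Box-counting dimensions: for a compact set $A$ in a metric space and $\delta>0$, $N(A,\delta)$ is the smallest number of sets of diameter at most $\delta$ that form a cover of $A$. The upper box-counting dimension is $\dim_{B}(A)=\limsup_{\delta\searrow 0}\frac{\log N(A,\delta)}{-\log\delta}$. The product $F\times G\subset\mathbb{R}^2$ carries the Euclidean metric. Construction of $F$ and $G$: let $\mathbb{N}=\{0,1,2,\dots\}$ and $K_j=10^{2^j}$ for $j\in\mathbb{N}$. For $k\in\{3,5,7\}$ the generator $\mathrm{gen}_k$ acts on a finite disjoint union of closed intervals by removing from each interval its open middle part of proportion $\frac{k-2}{k}$, i.e. it replaces each interval $[a,b]$ by the two intervals $[a,a+\frac{b-a}{k}]$ and $[b-\frac{b-a}{k},b]$. Put $F_0=G_0=[0,1]$. For $j\ge 1$, $F_j$ is obtained from $F_{j-1}$ by applying (at stage $j$) $\mathrm{gen}_3$ if $K_{6n}<j\le K_{6n+1}$ for some $n\in\mathbb{N}$, $\mathrm{gen}_7$ if $K_{6n+1}<j\le K_{6n+2}$ for some $n\in\mathbb{N}$, and $\mathrm{gen}_5$ otherwise. For $j\ge1$, $G_j$ is obtained from $G_{j-1}$ by applying $\mathrm{gen}_3$ if $K_{6m+3}<j\le K_{6m+4}$ for some $m\in\mathbb{N}$, $\mathrm{gen}_7$ if $K_{6m+4}<j\le K_{6m+5}$ for some $m\in\mathbb{N}$, and $\mathrm{gen}_5$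 otherwise. Finally $F=\bigcap_{j\ge0}F_j$ and $G=\bigcap_{j\ge0}G_j$. *)

theory Defs
  imports "HOL-Analysis.Analysis"
begin

(* The library's diameter is a real number and carries no information for unbounded
   sets, hence the explicit boundedness requirement.  For compact A and \<delta> > 0 a
   finite cover of this kind always exists, so the LEAST is well defined there. *)
definition covering_number :: "'a::metric_space set \<Rightarrow> real \<Rightarrow> nat" where
  "covering_number A \<delta> =
     (LEAST n. \<exists>\<C>. finite \<C> \<and> card \<C> = n \<and> A \<subseteq> \<Union>\<C> \<and>
                    (\<forall>U\<in>\<C>. bounded U \<and> diameter U \<le> \<delta>))"

definition upper_box_dim :: "'a::metric_space set \<Rightarrow> ereal" where
  "upper_box_dim A =
     Limsup (at_right 0) (\<lambda>\<delta>. ereal (ln (real (covering_number A \<delta>)) / (- ln \<delta>)))"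

(* A finite disjoint union of closed intervals is represented by the set of the
   endpoint pairs (a, b) of its constituent intervals. *)
definition gen :: "nat \<Rightarrow> (real \<times> real) set \<Rightarrow> (real \<times> real) set" where
  "gen k I = (\<Union>(a, b)\<in>I. {(a, a + (b - a) / real k), (b - (b - a) / real k, b)})"

definition interval_union :: "(real \<times> real) set \<Rightarrow> real set" where
  "interval_union I = (\<Union>(a, b)\<in>I. {a..b})"

definition K :: "nat \<Rightarrow> nat" where
  "K j = 10 ^ (2 ^ j)"

definition F_index :: "nat \<Rightarrow> nat" where
  "F_index j =
     (if \<exists>n. K (6 * n) < j \<and> j \<le> K (6 * n + 1) then 3
      else if \<exists>n. K (6 * n + 1) < j \<and> j \<le> K (6 * n + 2) then 7
      else 5)"

definition G_index :: "nat \<Rightarrow> nat" where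
  "G_index j =
     (if \<exists>m. K (6 * m + 3) < j \<and> j \<le> K (6 * m + 4) then 3
      else if \<exists>m. K (6 * m + 4) < j \<and> j \<le> K (6 * m + 5) then 7
      else 5)"

primrec F_intervals :: "nat \<Rightarrow> (real \<times> real) set" where
  "F_intervals 0 = {(0, 1)}"
| "F_intervals (Suc j) = gen (F_index (Suc j)) (F_intervals j)"

primrec G_intervals :: "nat \<Rightarrow> (real \<times> real) set" where
  "G_intervals 0 = {(0, 1)}"
| "G_intervals (Suc j) = gen (G_index (Suc j)) (G_intervals j)"

definition F_set :: "real set" where
  "F_set = (\<Inter>j. interval_union (F_intervals j))"

definition G_set :: "real set" where
  "G_set = (\<Inter>j. interval_union (G_intervals j))"

end

theory Submission
  imports Defs "HOL-Real_Asymp.Real_Asymp"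
begin

text \<open>
  Both sets are Cantor sets that split every interval in two at each stage and shrink it by a
  factor \<open>k i \<ge> 3\<close> at stage \<open>i\<close>. With \<open>S j\<close> the product of the first \<open>j\<close> factors, \<open>2 ^ j\<close>
  intervals of length \<open>1 / S j\<close> cover the set, and no fewer sets of that diameter suffice. So at
  scale \<open>1 / S j\<close> the dimension quotient is \<open>j * ln 2 / ln (S j)\<close>: it is large where the
  geometric mean of the factors used so far is small.

  Because \<open>K (m + 1) = (K m)\<^sup>2\<close>, each window of stages is so much longer than everything before
  it that it alone decides this mean. At the end of each window of factors 3 the mean is close to
  3, so the limit superior is at least \<open>ln 2 / ln 3\<close> for either set
  (\<open>upper_box_dim_ge_if_long_runs_of_3\<close>). The two sets reach these extremes at very different
  scales, though: while the mean of one is below 5, the other has been using the factor 5 for a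
  long time. Hence at every stage \<open>j\<close> one of the two sets has \<open>S j \<ge> 4 ^ j\<close>
  (\<open>ratio_prod_F_or_G_ge_power_4\<close>), whereas \<open>S j \<ge> 3 ^ j\<close> always holds. Covering the product by
  rectangles at scale \<open>\<delta>\<close> therefore takes about \<open>2 ^ (p + q)\<close> of them, where \<open>4 ^ p\<close> and
  \<open>3 ^ q\<close> are about \<open>1 / \<delta>\<close>, which bounds its dimension by
  \<open>ln 2 / ln 4 + ln 2 / ln 3 = 1 / 2 + ln 2 / ln 3\<close> (\<open>upper_box_dim_cantor_set_prod_le\<close>).
  This is less than \<open>2 * ln 2 / ln 3\<close>, since \<open>ln 3 < ln 4\<close>.
\<close>

section \<open>Covering numbers\<close>

lemma covering_number_le_card:
  assumes "finite \<C>" "A \<subseteq> \<Union>\<C>" "\<And>U. U \<in> \<C> \<Longrightarrow> bounded U \<and> diameter U \<le> \<delta>"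
  shows "covering_number A \<delta> \<le> card \<C>"
  unfolding covering_number_def using assms by (intro Least_le) blast

text \<open>
  A set of diameter at most \<open>\<delta>\<close> contains at most one point of \<open>P\<close>. The finite cover in the
  hypotheses guarantees that the minimum defining the covering number is attained.
\<close>

lemma card_separated_le_covering_number:
  fixes A :: "'a::metric_space set"
  assumes cover: "finite \<C>" "A \<subseteq> \<Union>\<C>" "\<And>U. U \<in> \<C> \<Longrightarrow> bounded U \<and> diameter U \<le> \<delta>"
    and "P \<subseteq> A" and sep: "\<And>x y. x \<in> P \<Longrightarrow> y \<in> P \<Longrightarrow> x \<noteq> y \<Longrightarrow> \<delta> < dist x y"
  shows "card P \<le> covering_number A \<delta>"
proof -
  let ?Q = "\<lambda>n. \<exists>\<C>. finite \<C> \<and> card \<C> = n \<and> A \<subseteq> \<Union>\<C> \<and>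
                    (\<forall>U\<in>\<C>. bounded U \<and> diameter U \<le> \<delta>)"
  have "?Q (covering_number A \<delta>)"
    unfolding covering_number_def using cover by (intro LeastI[of ?Q "card \<C>"]) blast
  then obtain \<D> where D: "finite \<D>" "card \<D> = covering_number A \<delta>" "A \<subseteq> \<Union>\<D>"
      "\<And>U. U \<in> \<D> \<Longrightarrow> bounded U \<and> diameter U \<le> \<delta>"
    by blast
  have "\<forall>x\<in>P. \<exists>U\<in>\<D>. x \<in> U"
    using D(3) \<open>P \<subseteq> A\<close> by blast
  then obtain f where f: "\<And>x. x \<in> P \<Longrightarrow> f x \<in> \<D> \<and> x \<in> f x"
    by metis
  have "inj_on f P"
  proof (rule inj_onI, rule ccontr)
    fix x y assume xy: "x \<in> P" "y \<in> P" "f x = f y" "x \<noteq> y"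
    then have "dist x y \<le> diameter (f x)"
      using f[of x] f[of y] D(4)[of "f x"] by (intro diameter_bounded_bound) auto
    with D(4)[of "f x"] f[of x] sep[of x y] xy show False by force
  qed
  then have "card P \<le> card \<D>"
    using f D(1) by (intro card_inj_on_le[of f]) auto
  with D(2) show ?thesis by simp
qed

section \<open>Cantor sets with varying contraction ratios\<close>

text \<open>
  The reciprocal of the common length of the intervals of stage \<open>j\<close>.
\<close>

definition ratio_prod :: "(nat \<Rightarrow> nat) \<Rightarrow> nat \<Rightarrow> real" where
  "ratio_prod k j = (\<Prod>i\<in>{1..j}. real (k i))"

text \<open>
  All intervals of a stage have the same length, so the left endpoints alone determine the stage,
  and the recursion turns into a union of two translates.
\<close>

primrec left_ends :: "(nat \<Rightarrow> nat) \<Rightarrow> nat \<Rightarrow> real set" where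
  "left_ends k 0 = {0}"
| "left_ends k (Suc j) =
     left_ends k j \<union> (\<lambda>a. a + (1 - 1 / real (k (Suc j))) / ratio_prod k j) ` left_ends k j"

definition cantor_set :: "(nat \<Rightarrow> nat) \<Rightarrow> real set" where
  "cantor_set k = (\<Inter>j. \<Union>a\<in>left_ends k j. {a..a + 1 / ratio_prod k j})"

lemma ratio_prod_0 [simp]: "ratio_prod k 0 = 1"
  by (simp add: ratio_prod_def)

lemma ratio_prod_Suc [simp]: "ratio_prod k (Suc j) = ratio_prod k j * real (k (Suc j))"
  by (simp add: ratio_prod_def)

lemma ratio_prod_pos:
  assumes "\<forall>i. 3 \<le> k i"
  shows "0 < ratio_prod k j"
proof -
  have "0 < k i" for i using assms[rule_format, of i] by simp
  then show ?thesis unfolding ratio_prod_def by (intro prod_pos) auto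
qed

lemma ratio_prod_ge_power_3:
  assumes "\<forall>i. 3 \<le> k i"
  shows "3 ^ j \<le> ratio_prod k j"
proof (induction j)
  case (Suc j)
  have "3 ^ j * 3 \<le> ratio_prod k j * real (k (Suc j))"
    using Suc assms[rule_format, of "Suc j"] ratio_prod_pos[OF assms, of j] by (intro mult_mono) auto
  then show ?case by simp
qed simp

lemma gen_eq_left_ends:
  assumes "\<forall>i. 3 \<le> k i"
  shows "gen (k (Suc j)) ((\<lambda>a. (a, a + 1 / ratio_prod k j)) ` left_ends k j) =
         (\<lambda>a. (a, a + 1 / ratio_prod k (Suc j))) ` left_ends k (Suc j)"
proof -
  have "k (Suc j) \<noteq> 0" using assms[rule_format, of "Suc j"] by simp
  then have "b + 1 / ratio_prod k j - 1 / ratio_prod k j / real (k (Suc j)) =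
          b + (1 - 1 / real (k (Suc j))) / ratio_prod k j"
       "b + 1 / ratio_prod k j = b + (1 - 1 / real (k (Suc j))) / ratio_prod k j
           + 1 / (ratio_prod k j * real (k (Suc j)))" for b
    using ratio_prod_pos[OF assms, of j] by (simp_all add: field_simps)
  then show ?thesis
    by (fastforce simp: gen_def image_iff)
qed

lemma interval_union_left_ends:
  "interval_union ((\<lambda>a. (a, a + c)) ` L) = (\<Union>a\<in>L. {a..a + c})"
  by (auto simp: interval_union_def)

lemma finite_left_ends: "finite (left_ends k j)"
  by (induction j) auto

lemma card_left_ends_le: "card (left_ends k j) \<le> 2 ^ j"
proof (induction j)
  case (Suc j)
  have "card (left_ends k (Suc j)) \<le> card (left_ends k j) + card (left_ends k j)"
    unfolding left_ends.simps
    by (intro order_trans[OF card_Un_le] add_mono card_image_le finite_left_ends order_refl)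
  with Suc show ?case by simp
qed simp

text \<open>
  An interval of length \<open>L\<close> is split with a factor \<open>c \<ge> 3\<close>, so the gap \<open>(1 - 2 / c) * L\<close> is at
  least as long as the two new intervals. This gap keeps two new left endpoints at least two new
  lengths apart; those in different old intervals inherit the bound from the previous stage.
\<close>

lemma left_ends_separated:
  assumes "\<forall>i. 3 \<le> k i" "x \<in> left_ends k j" "y \<in> left_ends k j" "x \<noteq> y"
  shows "2 / ratio_prod k j \<le> \<bar>x - y\<bar>"
  using assms(2-)
proof (induction j arbitrary: x y)
  case (Suc j)
  define s where "s = ratio_prod k j"
  define c where "c = real (k (Suc j))"
  define d where "d = (1 - 1 / c) / s"
  have c: "3 \<le> c" using assms(1)[rule_format, of "Suc j"] by (simp add: c_def)
  have s: "0 < s" using ratio_prod_pos[OF assms(1)] by (simp add: s_def)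
  \<comment> \<open>The first bound is where \<open>3 \<le> c\<close> enters; it separates the two halves of one interval.\<close>
  have d: "2 / (s * c) \<le> d" "0 \<le> d" "d + 2 / (s * c) \<le> 2 / s"
    using c s by (auto simp: d_def field_simps)
  obtain u e where u: "u \<in> left_ends k j" "x = u + e" "e = 0 \<or> e = d"
    using Suc.prems(1) by (fastforce simp: d_def c_def s_def)
  obtain v e' where v: "v \<in> left_ends k j" "y = v + e'" "e' = 0 \<or> e' = d"
    using Suc.prems(2) by (fastforce simp: d_def c_def s_def)
  have "2 / (s * c) \<le> \<bar>x - y\<bar>"
  proof (cases "u = v")
    case True
    then show ?thesis using u v d Suc.prems(3) by auto
  next
    case False
    then have "2 / s \<le> \<bar>u - v\<bar>" using Suc.IH u v by (simp add: s_def)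
    then show ?thesis using u v d by auto
  qed
  then show ?case by (simp add: s_def c_def)
qed simp

lemma card_left_ends:
  assumes "\<forall>i. 3 \<le> k i"
  shows "card (left_ends k j) = 2 ^ j"
proof (induction j)
  case (Suc j)
  define d where "d = (1 - 1 / real (k (Suc j))) / ratio_prod k j"
  have d: "0 < d" "d < 2 / ratio_prod k j"
    using assms[rule_format, of "Suc j"] ratio_prod_pos[OF assms, of j]
    by (auto simp: d_def field_simps add_pos_pos)
  have "left_ends k j \<inter> (\<lambda>a. a + d) ` left_ends k j = {}"
    using left_ends_separated[OF assms, of _ j] d by fastforce
  moreover have "card ((\<lambda>a. a + d) ` left_ends k j) = card (left_ends k j)"
    by (intro card_image inj_onI) auto
  ultimately show ?case
    using Suc finite_left_ends[of k j] by (simp add: card_Un_disjoint flip: d_def)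
qed simp

text \<open>
  Later stages are contained in earlier ones, and a left endpoint remains a left endpoint at all
  later stages.
\<close>

lemma left_ends_subset_cantor_set:
  assumes "\<forall>i. 3 \<le> k i"
  shows "left_ends k j \<subseteq> cantor_set k"
proof -
  let ?U = "\<lambda>j. \<Union>a\<in>left_ends k j. {a..a + 1 / ratio_prod k j}"
  have pos: "0 < ratio_prod k i" for i using ratio_prod_pos[OF assms] .
  have "?U (Suc i) \<subseteq> ?U i" for i
  proof
    fix x assume "x \<in> ?U (Suc i)"
    then obtain b where b: "b \<in> left_ends k (Suc i)" "b \<le> x" "x \<le> b + 1 / ratio_prod k (Suc i)"
      by auto
    define d where "d = (1 - 1 / real (k (Suc i))) / ratio_prod k i"
    have d: "0 \<le> d" "d + 1 / ratio_prod k (Suc i) = 1 / ratio_prod k i"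
      using assms[rule_format, of "Suc i"] pos[of i] by (auto simp: d_def field_simps)
    obtain a where "a \<in> left_ends k i" "b = a \<or> b = a + d"
      using b(1) by (auto simp: d_def)
    with b d have "a \<in> left_ends k i" "x \<in> {a..a + 1 / ratio_prod k i}" by auto
    then show "x \<in> ?U i" by blast
  qed
  then have nested: "?U n \<subseteq> ?U m" if "m \<le> n" for m n
    using that by (rule lift_Suc_antimono_le)
  have incl: "left_ends k m \<subseteq> left_ends k n" if "m \<le> n" for m n
    using that by (rule lift_Suc_mono_le[rotated]) auto
  have own: "left_ends k i \<subseteq> ?U i" for i
    using pos[of i] by force
  have "left_ends k j \<subseteq> ?U i" for i
    using incl[of j i] own[of i] own[of j] nested[of i j] by (cases "j \<le> i") auto
  then show ?thesis by (auto simp: cantor_set_def)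
qed

text \<open>
  The \<open>2 ^ j\<close> left endpoints lie in the set itself and are pairwise too far apart for two of them
  to share a covering set.
\<close>

lemma covering_number_cantor_set_ge:
  assumes "\<forall>i. 3 \<le> k i"
  shows "2 ^ j \<le> covering_number (cantor_set k) (1 / ratio_prod k j)"
proof -
  have pos: "0 < ratio_prod k j" using ratio_prod_pos[OF assms] .
  have "card (left_ends k j) \<le> covering_number (cantor_set k) (1 / ratio_prod k j)"
  proof (rule card_separated_le_covering_number)
    show "cantor_set k \<subseteq> \<Union>((\<lambda>a. {a..a + 1 / ratio_prod k j}) ` left_ends k j)"
      by (auto simp: cantor_set_def)
    show "1 / ratio_prod k j < dist x y" if "x \<in> left_ends k j" "y \<in> left_ends k j" "x \<noteq> y" for x y
    proof -
      have "1 / ratio_prod k j < 2 / ratio_prod k j" using pos by (simp add: field_simps)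
      with left_ends_separated[OF assms that] show ?thesis by (simp add: dist_real_def)
    qed
  qed (use pos in \<open>auto simp: finite_left_ends left_ends_subset_cantor_set[OF assms]\<close>)
  with card_left_ends[OF assms, of j] show ?thesis by simp
qed

text \<open>
  The stages \<open>p\<close> and \<open>q\<close> are independent: two Cantor sets with different factors reach a given
  scale \<open>\<delta>\<close> after different numbers of steps.
\<close>

lemma covering_number_cantor_set_prod_le:
  assumes "\<forall>i. 3 \<le> k i" "\<forall>i. 3 \<le> l i" "1 / ratio_prod k p + 1 / ratio_prod l q \<le> \<delta>"
  shows "covering_number (cantor_set k \<times> cantor_set l) \<delta> \<le> 2 ^ (p + q)"
proof -
  define box where
    "box = (\<lambda>(a, b). {a..a + 1 / ratio_prod k p} \<times> {b..b + 1 / ratio_prod l q})"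
  let ?L = "left_ends k p \<times> left_ends l q"
  have pos: "0 < ratio_prod k p" "0 < ratio_prod l q"
    using ratio_prod_pos assms(1,2) by blast+
  have box: "bounded (box z) \<and> diameter (box z) \<le> \<delta>" for z
  proof -
    obtain a b where z: "z = (a, b)" by fastforce
    have "diameter (box z) \<le> 1 / ratio_prod k p + 1 / ratio_prod l q"
    proof (rule diameter_le)
      fix v w assume "v \<in> box z" "w \<in> box z"
      then have "norm (fst (v - w)) \<le> 1 / ratio_prod k p" "norm (snd (v - w)) \<le> 1 / ratio_prod l q"
        by (auto simp: box_def z)
      moreover have "norm (v - w) \<le> norm (fst (v - w)) + norm (snd (v - w))"
        by (metis norm_Pair_le prod.collapse)
      ultimately show "norm (v - w) \<le> 1 / ratio_prod k p + 1 / ratio_prod l q" by linarith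
    qed (use pos in auto)
    then show ?thesis using assms(3) by (auto simp: box_def z bounded_Times)
  qed
  have "covering_number (cantor_set k \<times> cantor_set l) \<delta> \<le> card (box ` ?L)"
  proof (rule covering_number_le_card)
    show "cantor_set k \<times> cantor_set l \<subseteq> \<Union>(box ` ?L)"
    proof clarify
      fix x y assume "x \<in> cantor_set k" "y \<in> cantor_set l"
      then obtain a b where "a \<in> left_ends k p" "x \<in> {a..a + 1 / ratio_prod k p}"
          "b \<in> left_ends l q" "y \<in> {b..b + 1 / ratio_prod l q}"
        unfolding cantor_set_def by blast
      then show "(x, y) \<in> \<Union>(box ` ?L)" by (force simp: box_def)
    qed
  qed (use box in \<open>auto simp: finite_left_ends\<close>)
  also have "\<dots> \<le> card ?L"
    by (intro card_image_le finite_cartesian_product finite_left_ends)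
  also have "\<dots> \<le> 2 ^ p * 2 ^ q"
    unfolding card_cartesian_product by (intro mult_le_mono card_left_ends_le)
  finally show ?thesis by (simp add: power_add)
qed

section \<open>Bounds for the upper box dimension\<close>

text \<open>
  A limit superior as \<open>\<delta>\<close> tends to 0 is bounded below along any sequence of scales; the scales
  used here are the interval lengths of the stages \<open>j n\<close>.
\<close>

lemma upper_box_dim_cantor_set_ge:
  assumes k: "\<forall>i. 3 \<le> k i" and j: "filterlim j at_top sequentially"
    and lim: "(\<lambda>n. real (j n) * ln 2 / ln (ratio_prod k (j n))) \<longlonglongrightarrow> D"
  shows "ereal D \<le> upper_box_dim (cantor_set k)"
proof -
  let ?r = "\<lambda>\<delta>. ereal (ln (real (covering_number (cantor_set k) \<delta>)) / (- ln \<delta>))"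
  let ?d = "\<lambda>n. 1 / ratio_prod k (j n)"
  have pos: "0 < ratio_prod k i" for i using ratio_prod_pos[OF k] .
  have "filterlim (\<lambda>n. (3::real) ^ n) at_top sequentially" by real_asymp
  then have "filterlim (\<lambda>n. ratio_prod k n) at_top sequentially"
    by (rule filterlim_at_top_mono) (use ratio_prod_ge_power_3[OF k] in simp)
  then have top: "filterlim (\<lambda>n. ratio_prod k (j n)) at_top sequentially"
    using j by (rule filterlim_compose)
  have small: "filterlim ?d (at_right 0) sequentially"
    using filterlim_compose[OF filterlim_inverse_at_right_top top] by (simp add: inverse_eq_divide)
  have le: "ereal (real (j n) * ln 2 / ln (ratio_prod k (j n))) \<le> ?r (?d n)" for n
  proof -
    have "(2::real) ^ j n \<le> real (covering_number (cantor_set k) (?d n))"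
      using covering_number_cantor_set_ge[OF k, of "j n"]
      by (metis of_nat_le_iff of_nat_numeral of_nat_power)
    then have "ln ((2::real) ^ j n) \<le> ln (real (covering_number (cantor_set k) (?d n)))"
      by (intro ln_mono) auto
    moreover have "(1::real) \<le> 3 ^ j n" by simp
    then have "0 \<le> ln (ratio_prod k (j n))"
      using ratio_prod_ge_power_3[OF k, of "j n"] by (intro ln_ge_zero) linarith
    ultimately show ?thesis
      using pos[of "j n"] by (simp add: ln_realpow ln_div divide_right_mono)
  qed
  show ?thesis
    unfolding upper_box_dim_def
  proof (rule ccontr)
    assume "\<not> ereal D \<le> Limsup (at_right 0) ?r"
    then have "Limsup (at_right 0) ?r < ereal D" by (rule not_le_imp_less)
    from dense[OF this] obtain y where y: "Limsup (at_right 0) ?r < y" "y < ereal D"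
      by blast
    have "\<forall>\<^sub>F \<delta> in at_right 0. ?r \<delta> < y"
      using y(1) by (rule Limsup_lessD)
    then have "\<forall>\<^sub>F n in sequentially. ?r (?d n) < y"
      using small by (rule eventually_compose_filterlim)
    moreover have "\<forall>\<^sub>F n in sequentially. y < ereal (real (j n) * ln 2 / ln (ratio_prod k (j n)))"
      by (rule order_tendstoD(1)[OF tendsto_ereal[OF lim] y(2)])
    ultimately have "\<forall>\<^sub>F n in sequentially. False"
    proof eventually_elim
      case (elim n)
      then have "?r (?d n) < ?r (?d n)" using le[of n] by (metis less_trans less_le_trans)
      then show ?case using less_irrefl by blast
    qed
    then show False by simp
  qed
qed

text \<open>
  At the stage \<open>p\<close> where \<open>4 ^ p\<close> passes \<open>2 / \<delta>\<close>, the hypothesis names a factor of the product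
  whose intervals are short enough already; for the other factor the stage \<open>q\<close> where \<open>3 ^ q\<close>
  passes \<open>2 / \<delta>\<close> always suffices. Which factor it is may depend on \<open>\<delta>\<close>, but the number
  \<open>2 ^ (p + q)\<close> of rectangles does not. The summands 1 in the bound below account for rounding
  \<open>p\<close> and \<open>q\<close> up, and vanish in the limit.
\<close>

lemma upper_box_dim_cantor_set_prod_le:
  assumes k: "\<forall>i. 3 \<le> k i" and l: "\<forall>i. 3 \<le> l i"
    and alt: "\<And>j. 4 ^ j \<le> ratio_prod k j \<or> 4 ^ j \<le> ratio_prod l j"
  shows "upper_box_dim (cantor_set k \<times> cantor_set l) \<le> ereal (1 / 2 + ln 2 / ln 3)"
proof -
  let ?N = "\<lambda>\<delta>. covering_number (cantor_set k \<times> cantor_set l) \<delta>"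
  let ?h = "\<lambda>\<delta>::real. ((ln (2 / \<delta>) / ln 4 + 1) + (ln (2 / \<delta>) / ln 3 + 1)) * ln 2 / (- ln \<delta>)"
  have bound: "ln (real (?N \<delta>)) / (- ln \<delta>) \<le> ?h \<delta>" if \<delta>: "0 < \<delta>" "\<delta> < 1" for \<delta>
  proof -
    define p where "p = nat \<lceil>ln (2 / \<delta>) / ln 4\<rceil>"
    define q where "q = nat \<lceil>ln (2 / \<delta>) / ln 3\<rceil>"
    have t: "0 < ln (2 / \<delta>)" using \<delta> by simp
    have p: "ln (2 / \<delta>) / ln 4 \<le> real p" "real p \<le> ln (2 / \<delta>) / ln 4 + 1"
      and q: "ln (2 / \<delta>) / ln 3 \<le> real q" "real q \<le> ln (2 / \<delta>) / ln 3 + 1"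
      using t by (auto simp: p_def q_def ceiling_correct)
    have "ln (2 / \<delta>) \<le> ln (4 ^ p)" "ln (2 / \<delta>) \<le> ln (3 ^ q)"
      using p(1) q(1) by (auto simp: ln_realpow field_simps)
    then have pq: "2 / \<delta> \<le> 4 ^ p" "2 / \<delta> \<le> 3 ^ q"
      using \<delta> by (auto simp del: ln_le_cancel_iff simp: ln_le_cancel_iff)
    have half: "1 / s \<le> \<delta> / 2" if "2 / \<delta> \<le> s" for s
    proof -
      have "0 < 2 / \<delta>" using \<delta> by simp
      then have "0 < s" using that by linarith
      then show ?thesis using that \<delta> by (simp add: field_simps)
    qed
    \<comment> \<open>Each side of a rectangle gets half of the permitted diameter.\<close>
    have "?N \<delta> \<le> 2 ^ (p + q)"
    proof (cases "4 ^ p \<le> ratio_prod k p")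
      case True
      then have "1 / ratio_prod k p + 1 / ratio_prod l q \<le> \<delta>"
        using half[of "ratio_prod k p"] half[of "ratio_prod l q"] pq ratio_prod_ge_power_3[OF l, of q] by linarith
      then show ?thesis by (rule covering_number_cantor_set_prod_le[OF k l])
    next
      case False
      then have "4 ^ p \<le> ratio_prod l p" using alt by blast
      then have "1 / ratio_prod k q + 1 / ratio_prod l p \<le> \<delta>"
        using half[of "ratio_prod l p"] half[of "ratio_prod k q"] pq ratio_prod_ge_power_3[OF k, of q] by linarith
      then show ?thesis
        using covering_number_cantor_set_prod_le[OF k l, of q p] by (simp add: add.commute)
    qed
    then have N: "real (?N \<delta>) \<le> 2 ^ (p + q)"
      by (metis of_nat_le_iff of_nat_numeral of_nat_power)
    have "ln (real (?N \<delta>)) \<le> real (p + q) * ln 2"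
    proof (cases "?N \<delta> = 0")
      case False
      then have "ln (real (?N \<delta>)) \<le> ln (2 ^ (p + q))" using N by (intro ln_mono) auto
      then show ?thesis by (simp add: ln_realpow)
    qed simp
    also have "\<dots> \<le> ((ln (2 / \<delta>) / ln 4 + 1) + (ln (2 / \<delta>) / ln 3 + 1)) * ln 2"
      using p(2) q(2) by (intro mult_right_mono) auto
    finally show ?thesis using \<delta> by (intro divide_right_mono) auto
  qed
  have "(?h \<longlongrightarrow> (inverse (ln 4) + inverse (ln 3)) * ln 2) (at_right 0)"
    by real_asymp
  moreover have "ln (4::real) = 2 * ln 2"
    using ln_realpow[of 2 2] by simp
  then have "(inverse (ln 4) + inverse (ln 3)) * ln 2 = 1 / 2 + ln 2 / ln (3::real)"
    by (simp add: field_simps)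
  ultimately have lim: "Limsup (at_right 0) (\<lambda>\<delta>. ereal (?h \<delta>)) = ereal (1 / 2 + ln 2 / ln 3)"
    by (intro lim_imp_Limsup) auto
  have "\<forall>\<^sub>F \<delta> in at_right (0::real). 0 < \<delta> \<and> \<delta> < 1"
    by (intro eventually_at_rightI[of 0 1]) auto
  then have "\<forall>\<^sub>F \<delta> in at_right 0. ereal (ln (real (?N \<delta>)) / (- ln \<delta>)) \<le> ereal (?h \<delta>)"
    by eventually_elim (use bound in simp)
  then show ?thesis
    unfolding upper_box_dim_def lim[symmetric] by (rule Limsup_mono)
qed

section \<open>Growth of the scales\<close>

lemma K_Suc: "K (Suc m) = K m * K m"
  by (simp add: K_def mult_2 flip: power_add)

lemma K_ge_10: "10 \<le> K m"
proof -
  have "(10::nat) ^ 1 \<le> 10 ^ (2 ^ m)" by (intro power_increasing) auto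
  then show ?thesis by (simp add: K_def)
qed

lemma strict_mono_K: "strict_mono K"
  by (intro strict_monoI) (simp add: K_def)

text \<open>
  Once the factors 5 occupy two thirds of the stages, they outweigh arbitrarily many initial
  factors that are only at least 3, because \<open>4 ^ 3 = 64 \<le> 75 = 3 * 5 ^ 2\<close>.
\<close>

lemma ratio_prod_ge_power_4:
  assumes k: "\<forall>i. 3 \<le> k i" and five: "\<And>i. M < i \<Longrightarrow> i \<le> j \<Longrightarrow> k i = 5" and "3 * M \<le> j"
  shows "4 ^ j \<le> ratio_prod k j"
proof -
  have "3 ^ M * 5 ^ d \<le> ratio_prod k (M + d)" if "M + d \<le> j" for d
    using that
  proof (induction d)
    case 0
    then show ?case using ratio_prod_ge_power_3[OF k] by simp
  next
    case (Suc d)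
    then show ?case using five[of "Suc (M + d)"] by simp
  qed
  from this[of "j - M"] have "3 ^ M * 5 ^ (j - M) \<le> ratio_prod k j"
    using \<open>3 * M \<le> j\<close> by simp
  have j: "j = 3 * M + (j - 3 * M)" "j - M = 2 * M + (j - 3 * M)"
    using \<open>3 * M \<le> j\<close> by auto
  have "(4::real) ^ j = 64 ^ M * 4 ^ (j - 3 * M)"
    by (subst j(1)) (simp add: power_add power_mult)
  also have "\<dots> \<le> 75 ^ M * 5 ^ (j - 3 * M)"
    by (intro mult_mono power_mono) simp_all
  also have "\<dots> = 3 ^ M * 5 ^ (j - M)"
    by (simp add: j(2) power_add power_mult flip: power_mult_distrib)
  also have "\<dots> \<le> ratio_prod k j" by fact
  finally show ?thesis .
qed

lemma ln_ratio_prod_le: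
  assumes k: "\<forall>i. 3 \<le> k i" "\<forall>i. k i \<le> 7" and three: "\<And>i. M < i \<Longrightarrow> i \<le> j \<Longrightarrow> k i = 3" and "M \<le> j"
  shows "ln (ratio_prod k j) \<le> real j * ln 3 + real M * ln 7"
proof -
  have pos: "0 < ratio_prod k i" for i using ratio_prod_pos[OF k(1)] .
  have "ratio_prod k i \<le> 7 ^ i" for i
  proof (induction i)
    case (Suc i)
    have "ratio_prod k i * real (k (Suc i)) \<le> 7 ^ i * 7"
      using Suc k(2)[rule_format, of "Suc i"] by (intro mult_mono) auto
    then show ?case by simp
  qed simp
  moreover have "ratio_prod k (M + d) = ratio_prod k M * 3 ^ d" if "M + d \<le> j" for d
    using that
  proof (induction d)
    case (Suc d)
    then show ?case using three[of "Suc (M + d)"] by simp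
  qed simp
  from this[of "j - M"] have "ratio_prod k j = ratio_prod k M * 3 ^ (j - M)"
    using \<open>M \<le> j\<close> by simp
  moreover have "(3::real) ^ (j - M) \<le> 3 ^ j" by (intro power_increasing) auto
  ultimately have "ratio_prod k j \<le> 7 ^ M * 3 ^ j"
    using pos[of M] by (auto intro!: mult_mono)
  then have "ln (ratio_prod k j) \<le> ln (7 ^ M * 3 ^ j)" using pos by (intro ln_mono) auto
  then show ?thesis by (simp add: ln_mult ln_realpow)
qed

text \<open>
  With \<open>x = K (g n)\<close>, a run of factors 3 ends at stage \<open>x\<^sup>2\<close>, and the first \<open>x\<close> stages
  contribute at most \<open>x * ln 7\<close> to the logarithm. The dimension quotient there is thus at least
  \<open>ln 2 / (ln 3 + ln 7 / x)\<close>.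
\<close>

lemma upper_box_dim_ge_if_long_runs_of_3:
  fixes g :: "nat \<Rightarrow> nat"
  assumes k: "\<forall>i. 3 \<le> k i" "\<forall>i. k i \<le> 7"
    and g: "strict_mono g"
    and three: "\<And>n i. K (g n) < i \<Longrightarrow> i \<le> K (Suc (g n)) \<Longrightarrow> k i = 3"
  shows "ereal (ln 2 / ln 3) \<le> upper_box_dim (cantor_set k)"
proof (rule upper_box_dim_cantor_set_ge)
  let ?x = "\<lambda>n. real (K (g n))"
  have "strict_mono (\<lambda>n. K (g n))" "strict_mono (\<lambda>n. K (Suc (g n)))"
    using strict_mono_K g by (auto simp: strict_mono_def)
  then have top: "filterlim (\<lambda>n. K (g n)) at_top sequentially"
    and top': "filterlim (\<lambda>n. K (Suc (g n))) at_top sequentially"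
    by (simp_all add: filterlim_subseq)
  show "filterlim (\<lambda>n. K (Suc (g n))) at_top sequentially" by (rule top')
  let ?S = "\<lambda>n. ratio_prod k (K (Suc (g n)))"
  let ?r = "\<lambda>n. real (K (Suc (g n))) * ln 2 / ln (?S n)"
  have x: "0 < ?x n" for n using K_ge_10[of "g n"] by simp
  have K: "real (K (Suc (g n))) = ?x n * ?x n" for n by (simp add: K_Suc)
  have lower: "real (K (Suc (g n))) * ln 3 \<le> ln (?S n)" for n
  proof -
    have "ln (3 ^ K (Suc (g n))) \<le> ln (?S n)"
      using ratio_prod_ge_power_3[OF k(1)] by (intro ln_mono) auto
    then show ?thesis by (simp add: ln_realpow)
  qed
  have upper: "ln (?S n) \<le> real (K (Suc (g n))) * ln 3 + ?x n * ln 7" for n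
    using strict_mono_less_eq[OF strict_mono_K] three by (intro ln_ratio_prod_le k) auto
  have pos: "0 < ln (?S n)" for n
  proof -
    have "0 < real (K (Suc (g n))) * ln 3" using x[of n] by (simp add: K)
    then show ?thesis using lower[of n] by linarith
  qed
  show "?r \<longlonglongrightarrow> ln 2 / ln 3"
  proof (rule tendsto_sandwich)
    have "((\<lambda>x::real. ln 2 / (ln 3 + ln 7 / x)) \<longlongrightarrow> ln 2 * inverse (ln 3)) at_top"
      by real_asymp
    then have "((\<lambda>x::real. ln 2 / (ln 3 + ln 7 / x)) \<longlongrightarrow> ln 2 / ln 3) at_top"
      by (simp add: divide_inverse)
    then show "(\<lambda>n. ln 2 / (ln 3 + ln 7 / ?x n)) \<longlonglongrightarrow> ln 2 / ln 3"
      by (rule filterlim_compose) (intro filterlim_compose[OF filterlim_real_sequentially top])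
    have "ln 2 / (ln 3 + ln 7 / ?x n) \<le> ?r n" for n
    proof -
      have "ln 2 / (ln 3 + ln 7 / ?x n) =
          (?x n * ?x n * ln 2) / (?x n * ?x n * (ln 3 + ln 7 / ?x n))"
        using x[of n] by simp
      also have "\<dots> = (?x n * ?x n * ln 2) / (?x n * ?x n * ln 3 + ?x n * ln 7)"
        using x[of n] by (simp add: distrib_left)
      also have "\<dots> \<le> ?r n"
        using upper[of n] pos[of n] x[of n] unfolding K
        by (intro divide_left_mono mult_pos_pos) auto
      finally show ?thesis .
    qed
    then show "\<forall>\<^sub>F n in sequentially. ln 2 / (ln 3 + ln 7 / ?x n) \<le> ?r n" by simp
    have "?r n \<le> ln 2 / ln 3" for n
    proof -
      have "ln 2 * (real (K (Suc (g n))) * ln 3) \<le> ln 2 * ln (?S n)"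
        using lower[of n] by (intro mult_left_mono) auto
      then show ?thesis using pos[of n] by (simp add: field_simps)
    qed
    then show "\<forall>\<^sub>F n in sequentially. ?r n \<le> ln 2 / ln 3" by simp
  qed simp
qed (rule k)

section \<open>The sets F and G\<close>

lemma F_index_bounds: "\<forall>i. 3 \<le> F_index i" "\<forall>i. F_index i \<le> 7"
  and G_index_bounds: "\<forall>i. 3 \<le> G_index i" "\<forall>i. G_index i \<le> 7"
  by (auto simp: F_index_def G_index_def)

lemma F_set_eq_cantor_set: "F_set = cantor_set F_index"
proof -
  have "F_intervals j = (\<lambda>a. (a, a + 1 / ratio_prod F_index j)) ` left_ends F_index j" for j
  proof (induction j)
    case (Suc j)
    then show ?case
      unfolding F_intervals.simps by (simp only: gen_eq_left_ends[OF F_index_bounds(1)])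
  qed simp
  then show ?thesis
    by (simp add: F_set_def cantor_set_def interval_union_left_ends)
qed

lemma G_set_eq_cantor_set: "G_set = cantor_set G_index"
proof -
  have "G_intervals j = (\<lambda>a. (a, a + 1 / ratio_prod G_index j)) ` left_ends G_index j" for j
  proof (induction j)
    case (Suc j)
    then show ?case
      unfolding G_intervals.simps by (simp only: gen_eq_left_ends[OF G_index_bounds(1)])
  qed simp
  then show ?thesis
    by (simp add: G_set_def cantor_set_def interval_union_left_ends)
qed

text \<open>
  Comparing the indices of two windows of stages is enough to see that they do not meet.
\<close>

lemma K_windows_disjoint:
  assumes "K a < i" "i \<le> K b" "d \<le> a \<or> b \<le> c"
  shows "\<not> (K c < i \<and> i \<le> K d)"
  using assms strict_mono_less_eq[OF strict_mono_K, of d a]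
    strict_mono_less_eq[OF strict_mono_K, of b c]
  by linarith

lemma F_index_eq_5:
  assumes "K (6 * n + 2) < i" "i \<le> K (6 * n + 6)"
  shows "F_index i = 5"
proof -
  have "\<not> (K (6 * m) < i \<and> i \<le> K (6 * m + 1))" for m
    by (rule K_windows_disjoint[OF assms]) presburger
  moreover have "\<not> (K (6 * m + 1) < i \<and> i \<le> K (6 * m + 2))" for m
    by (rule K_windows_disjoint[OF assms]) presburger
  ultimately show ?thesis by (simp add: F_index_def)
qed

lemma G_index_eq_5:
  assumes "K (6 * n + 5) < i" "i \<le> K (6 * n + 9)"
  shows "G_index i = 5"
proof -
  have "\<not> (K (6 * m + 3) < i \<and> i \<le> K (6 * m + 4))" for m
    by (rule K_windows_disjoint[OF assms]) presburger
  moreover have "\<not> (K (6 * m + 4) < i \<and> i \<le> K (6 * m + 5))" for m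
    by (rule K_windows_disjoint[OF assms]) presburger
  ultimately show ?thesis by (simp add: G_index_def)
qed

lemma G_index_eq_5_initial:
  assumes "i \<le> K 3"
  shows "G_index i = 5"
proof -
  have "K 3 \<le> K (6 * m + 3)" "K 3 \<le> K (6 * m + 4)" for m
    by (simp_all add: strict_mono_less_eq[OF strict_mono_K])
  then have "\<not> K (6 * m + 3) < i" "\<not> K (6 * m + 4) < i" for m
    using assms by (meson le_trans not_le)+
  then show ?thesis by (simp add: G_index_def)
qed

text \<open>
  \<open>F\<close> has factor 5 on the windows \<open>6n + 2\<close> to \<open>6n + 6\<close> of \<open>K\<close>, and \<open>G\<close> on the windows
  \<open>6n + 5\<close> to \<open>6n + 9\<close>. Inside such a range the mean has recovered as soon as one window has
  passed, since its end is the square of its beginning. The remaining parts, from \<open>6n + 3\<close> to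
  \<open>6n + 6\<close> and from \<open>6n + 6\<close> to \<open>6n + 9\<close>, together cover all stages beyond \<open>K 3\<close>; up to
  there \<open>G\<close> has only factors 5.
\<close>

lemma ratio_prod_F_or_G_ge_power_4: "4 ^ j \<le> ratio_prod F_index j \<or> 4 ^ j \<le> ratio_prod G_index j"
proof (cases "j \<le> K 3")
  case True
  then have "4 ^ j \<le> ratio_prod G_index j"
    by (intro ratio_prod_ge_power_4[where M = 0] G_index_bounds) (auto intro: G_index_eq_5_initial)
  then show ?thesis ..
next
  case False
  have long: "3 * K M \<le> j" if "K (Suc M) < j" for M
  proof -
    have "3 * K M \<le> K M * K M" using K_ge_10[of M] by (intro mult_right_mono) auto
    with that[unfolded K_Suc] show ?thesis by linarith
  qed
  have "j \<le> K j"
    using strict_mono_imp_increasing[OF strict_mono_K] by blast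
  define s where "s = (LEAST s. j \<le> K s)"
  have s: "j \<le> K s" unfolding s_def using \<open>j \<le> K j\<close> by (rule LeastI)
  have below: "K t < j" if "t < s" for t
    using not_less_Least[of t "\<lambda>s. j \<le> K s"] that by (simp add: s_def)
  have "3 < s"
    using False s strict_mono_less_eq[OF strict_mono_K, of s 3] by linarith
  \<comment> \<open>Stage \<open>j\<close> lies between \<open>K (s - 1)\<close> and \<open>K s\<close>; the residue of \<open>s\<close> modulo 6 tells which
    of the two sets has had factors 5 for at least a whole window.\<close>
  define n where "n = (s - 4) div 6"
  define r where "r = (s - 4) mod 6"
  have sr: "s = 6 * n + r + 4" "r < 6"
    using \<open>3 < s\<close> by (auto simp: n_def r_def)
  show ?thesis
  proof (cases "r < 3")
    case True
    have "K s \<le> K (6 * n + 6)" using True sr by (simp add: strict_mono_less_eq[OF strict_mono_K])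
    moreover have "K (Suc (6 * n + 2)) < j" using sr by (intro below) simp
    ultimately have "4 ^ j \<le> ratio_prod F_index j"
      using s by (intro ratio_prod_ge_power_4[where M = "K (6 * n + 2)"] F_index_bounds long)
        (auto intro: F_index_eq_5[of n])
    then show ?thesis ..
  next
    case False
    have "K s \<le> K (6 * n + 9)" using sr by (simp add: strict_mono_less_eq[OF strict_mono_K])
    moreover have "K (Suc (6 * n + 5)) < j" using sr False by (intro below) simp
    ultimately have "4 ^ j \<le> ratio_prod G_index j"
      using s by (intro ratio_prod_ge_power_4[where M = "K (6 * n + 5)"] G_index_bounds long)
        (auto intro: G_index_eq_5[of n])
    then show ?thesis ..
  qed
qed

lemma upper_box_dim_F_set_ge: "ereal (ln 2 / ln 3) \<le> upper_box_dim F_set"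
  unfolding F_set_eq_cantor_set
proof (rule upper_box_dim_ge_if_long_runs_of_3[where g = "\<lambda>n. 6 * n"])
  show "F_index i = 3" if "K (6 * n) < i" "i \<le> K (Suc (6 * n))" for n i
    using that by (auto simp: F_index_def)
qed (auto simp: F_index_bounds strict_mono_def)

lemma upper_box_dim_G_set_ge: "ereal (ln 2 / ln 3) \<le> upper_box_dim G_set"
  unfolding G_set_eq_cantor_set
proof (rule upper_box_dim_ge_if_long_runs_of_3[where g = "\<lambda>n. 6 * n + 3"])
  show "G_index i = 3" if "K (6 * n + 3) < i" "i \<le> K (Suc (6 * n + 3))" for n i
    using that by (auto simp: G_index_def eval_nat_numeral)
qed (auto simp: G_index_bounds strict_mono_def)

theorem corollary3p10:
  shows "upper_box_dim (F_set \<times> G_set) < upper_box_dim F_set + upper_box_dim G_set"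
proof -
  have "upper_box_dim (F_set \<times> G_set) \<le> ereal (1 / 2 + ln 2 / ln 3)"
    unfolding F_set_eq_cantor_set G_set_eq_cantor_set
    by (intro upper_box_dim_cantor_set_prod_le F_index_bounds G_index_bounds
        ratio_prod_F_or_G_ge_power_4)
  also have "ln (3::real) < ln (2 ^ 2)" by simp
  then have "ln (3::real) < 2 * ln 2" by (subst (asm) ln_realpow) simp_all
  then have "ereal (1 / 2 + ln 2 / ln 3) < ereal (ln 2 / ln 3) + ereal (ln 2 / ln 3)"
    by (simp add: field_simps)
  also have "\<dots> \<le> upper_box_dim F_set + upper_box_dim G_set"
    by (intro add_mono upper_box_dim_F_set_ge upper_box_dim_G_set_ge)
  finally show ?thesis .
qed

end
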